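(* Let $\mathcal{P}\subset\mathbb{R}^d$ ($d\ge1$) be a convex polyhedral space given by an irredundant family of affine inequalities, let $\widehat{\mathcal{P}}\subset\mathbb{R}^{d+1}$ be its cone, and let $k\ge0$. Then there is an isomorphism of vector spaces $$\mathrm{Poly}_\partial(\mathcal{P})_{\le k}\;\cong\;\overline{\mathrm{Poly}}_\partial(\widehat{\mathcal{P}})_k .$$
   Context: Let $\alpha_1,\ldots,\alpha_m\in\mathbb{R}^d\setminus\{0\}$, $\ell_1,\ldots,\ell_m\in\mathbb{R}$, $h_i(x)=\langle\alpha_i,x\rangle+\ell_i$, and $\mathcal{P}=\bigcap_{i=1}^m\{x\in\mathbb{R}^d\mid h_i(x)\le 0\}$ ($\mathcal{P}=\mathbb{R}^d$ if $m=0$). The representation is irredundant: for each $j$, $\mathcal{P}\subsetneq\bigcap_{i\ne j}\{h_i\le 0\}$. Put $H_i=\{h_i=0\}$ and $F_i=H_i\cap\partial\mathcal{P}$. $\mathrm{Poly}_\partial(\mathcal{P})_{\le k}$ is the real vector space of polynomial vector fields $\xi=(f_1,\ldots,f_d)$ on $\mathcal{P}$ with $f_q\in\mathbb{R}[x_1,\ldots,x_d]$, $\deg f_q\le k$, such that $\langle\xi(x),\alpha_i\rangle=0$ for all $x\in F_i$ and all $1\le i\le m$. The cone of $\mathcal{P}$ is $\widehat{\mathcal{P}}=\bigcap_{i=1}^m\{\widehat x=(x_0,\ldots,x_d)\in\mathbb{R}^{d+1}\mid\widehat h_i(\widehat x)\le 0\}$, where $\widehat h_i=\ell_ix_0+\sum_{q=1}^d(\alpha_i)_qx_q$;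 its supporting hyperplanes are $\widehat H_i=\{\widehat h_i=0\}$ with normal $\widehat\alpha_i=(\ell_i,(\alpha_i)_1,\ldots,(\alpha_i)_d)$, and its facets are $\widehat F_i=\widehat H_i\cap\partial\widehat{\mathcal{P}}$. $\mathrm{Poly}_\partial(\widehat{\mathcal{P}})_k$ is the space of vector fields $(\widehat f_0,\ldots,\widehat f_d)$ whose components are homogeneous polynomials of degree $k$ (or zero) in $\mathbb{R}[x_0,\ldots,x_d]$ and which are orthogonal to $\widehat\alpha_i$ at every point of $\widehat F_i$, for $1\le i\le m$. $\overline{\mathrm{Poly}}_\partial(\widehat{\mathcal{P}})_k$ is the subspace of those with $\widehat f_0=0$ (fields parallel to the hyperplane $x_0=0$).
   Formalization: The polyhedral space P is additionally assumed nonempty; for empty P the claim fails, e.g. d=1, h_1=x+1, h_2=-x+1, k=0, where the left side has dimension 1 and the right side dimension 0. *)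

theory Defs
  imports "HOL-Analysis.Analysis" "HOL-Library.Poly_Mapping"
begin

section \<open>Formal polynomials over the reals\<close>

type_synonym 'n rpoly = "('n \<Rightarrow>\<^sub>0 nat) \<Rightarrow>\<^sub>0 real"

text \<open>A polynomial in the variables \<open>x\<^sub>q\<close>, \<open>q :: 'n\<close>, maps exponent vectors to coefficients.
  The product on \<^typ>\<open>'n rpoly\<close> from \<^theory>\<open>HOL-Library.Poly_Mapping\<close> is the product of
  polynomials; only the vector space structure is missing there.\<close>

instantiation poly_mapping :: (type, real_vector) real_vector
begin

definition scaleR_poly_mapping :: "real \<Rightarrow> ('a \<Rightarrow>\<^sub>0 'b) \<Rightarrow> 'a \<Rightarrow>\<^sub>0 'b" where
  "scaleR_poly_mapping c p = Poly_Mapping.map (scaleR c) p"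

lemma lookup_scaleR [simp]:
  fixes p :: "'a \<Rightarrow>\<^sub>0 'b"
  shows "Poly_Mapping.lookup (c *\<^sub>R p) m = c *\<^sub>R Poly_Mapping.lookup p m"
  by (simp add: scaleR_poly_mapping_def Poly_Mapping.map.rep_eq when_def)

instance
  by standard
    (auto intro!: poly_mapping_eqI simp: lookup_add scaleR_right_distrib scaleR_left_distrib)

end

lemma keys_scaleR: "Poly_Mapping.keys (c *\<^sub>R p) \<subseteq> Poly_Mapping.keys p"
  by (auto simp: in_keys_iff)

definition mdeg :: "('n::finite \<Rightarrow>\<^sub>0 nat) \<Rightarrow> nat" where
  "mdeg m = (\<Sum>q\<in>UNIV. Poly_Mapping.lookup m q)"

text \<open>The zero polynomial satisfies both degree conditions for every \<open>k\<close>.\<close>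

definition deg_le :: "nat \<Rightarrow> 'n::finite rpoly \<Rightarrow> bool" where
  "deg_le k p \<longleftrightarrow> (\<forall>m\<in>Poly_Mapping.keys p. mdeg m \<le> k)"

definition homogeneous_of_deg :: "nat \<Rightarrow> 'n::finite rpoly \<Rightarrow> bool" where
  "homogeneous_of_deg k p \<longleftrightarrow> (\<forall>m\<in>Poly_Mapping.keys p. mdeg m = k)"

definition mpoly_eval :: "'n::finite rpoly \<Rightarrow> real ^ 'n \<Rightarrow> real" where
  "mpoly_eval p x = (\<Sum>m\<in>Poly_Mapping.keys p.
     Poly_Mapping.lookup p m * (\<Prod>q\<in>UNIV. (x $ q) ^ Poly_Mapping.lookup m q))"

section \<open>Polynomial vector fields\<close>

type_synonym 'n poly_field = "('n rpoly) ^ 'n"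

definition eval_field :: "'n::finite poly_field \<Rightarrow> real ^ 'n \<Rightarrow> real ^ 'n" where
  "eval_field \<xi> x = (\<chi> q. mpoly_eval (\<xi> $ q) x)"

section \<open>Polyhedra\<close>

text \<open>The family of inequalities \<open>h i x \<le> 0\<close> is indexed by \<open>1 \<le> i \<le> m\<close>; values of \<open>h\<close> at
  other indices play no role.\<close>

definition polyhedral_set :: "nat \<Rightarrow> (nat \<Rightarrow> 'a \<Rightarrow> real) \<Rightarrow> 'a set" where
  "polyhedral_set m h = (\<Inter>i\<in>{1..m}. {x. h i x \<le> 0})"

definition irredundant :: "nat \<Rightarrow> (nat \<Rightarrow> 'a \<Rightarrow> real) \<Rightarrow> bool" where
  "irredundant m h \<longleftrightarrow>
     (\<forall>j\<in>{1..m}. polyhedral_set m h \<subset> (\<Inter>i\<in>{1..m} - {j}. {x. h i x \<le> 0}))"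

definition facet :: "nat \<Rightarrow> (nat \<Rightarrow> 'a \<Rightarrow> real) \<Rightarrow> nat \<Rightarrow> 'a::topological_space set" where
  "facet m h i = {x. h i x = 0} \<inter> frontier (polyhedral_set m h)"

definition aff :: "(nat \<Rightarrow> real ^ 'n) \<Rightarrow> (nat \<Rightarrow> real) \<Rightarrow> nat \<Rightarrow> real ^ 'n::finite \<Rightarrow> real" where
  "aff \<alpha> \<l> i x = \<alpha> i \<bullet> x + \<l> i"

text \<open>\<open>\<real>\<^sup>d\<^sup>+\<^sup>1\<close> is \<open>real ^ 'n option\<close> with \<open>CARD('n) = d\<close>: the index \<^const>\<open>None\<close> is the additional
  coordinate \<open>0\<close>, and \<open>Some q\<close> is the old coordinate \<open>q\<close>.\<close>

definition cone_form ::
    "(nat \<Rightarrow> real ^ 'n) \<Rightarrow> (nat \<Rightarrow> real) \<Rightarrow> nat \<Rightarrow> real ^ ('n::finite) option \<Rightarrow> real" where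
  "cone_form \<alpha> \<l> i x = \<l> i * x $ None + (\<Sum>q\<in>UNIV. \<alpha> i $ q * x $ Some q)"

definition cone_normal ::
    "(nat \<Rightarrow> real ^ 'n) \<Rightarrow> (nat \<Rightarrow> real) \<Rightarrow> nat \<Rightarrow> real ^ ('n::finite) option" where
  "cone_normal \<alpha> \<l> i = (\<chi> r. case r of None \<Rightarrow> \<l> i | Some q \<Rightarrow> \<alpha> i $ q)"

lemma cone_form_eq_inner: "cone_form \<alpha> \<l> i x = cone_normal \<alpha> \<l> i \<bullet> x"
  by (simp add: cone_form_def cone_normal_def inner_vec_def UNIV_option_conv sum.reindex)

section \<open>Vector fields tangent to the facets\<close>

definition tangent_fields ::
    "nat \<Rightarrow> (nat \<Rightarrow> real ^ 'n \<Rightarrow> real) \<Rightarrow> (nat \<Rightarrow> real ^ 'n) \<Rightarrow> 'n::finite poly_field set" where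
  "tangent_fields m h \<nu> = {\<xi>. \<forall>i\<in>{1..m}. \<forall>x\<in>facet m h i. eval_field \<xi> x \<bullet> \<nu> i = 0}"

definition Poly_bd_le ::
    "nat \<Rightarrow> (nat \<Rightarrow> real ^ 'n) \<Rightarrow> (nat \<Rightarrow> real) \<Rightarrow> nat \<Rightarrow> 'n::finite poly_field set" where
  "Poly_bd_le m \<alpha> \<l> k = {\<xi> \<in> tangent_fields m (aff \<alpha> \<l>) \<alpha>. \<forall>q. deg_le k (\<xi> $ q)}"

definition Poly_bd_cone ::
    "nat \<Rightarrow> (nat \<Rightarrow> real ^ 'n) \<Rightarrow> (nat \<Rightarrow> real) \<Rightarrow> nat \<Rightarrow> ('n::finite) option poly_field set" where
  "Poly_bd_cone m \<alpha> \<l> k =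
     {\<xi> \<in> tangent_fields m (cone_form \<alpha> \<l>) (cone_normal \<alpha> \<l>). \<forall>r. homogeneous_of_deg k (\<xi> $ r)}"

definition Poly_bd_cone_par ::
    "nat \<Rightarrow> (nat \<Rightarrow> real ^ 'n) \<Rightarrow> (nat \<Rightarrow> real) \<Rightarrow> nat \<Rightarrow> ('n::finite) option poly_field set" where
  "Poly_bd_cone_par m \<alpha> \<l> k = {\<xi> \<in> Poly_bd_cone m \<alpha> \<l> k. \<xi> $ None = 0}"

section \<open>The spaces of vector fields are real vector spaces\<close>

lemma mpoly_eval_superset:
  assumes "finite A" "Poly_Mapping.keys p \<subseteq> A"
  shows "mpoly_eval p x = (\<Sum>m\<in>A. Poly_Mapping.lookup p m *
           (\<Prod>q\<in>UNIV. (x $ q) ^ Poly_Mapping.lookup m q))"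
  unfolding mpoly_eval_def using assms
  by (intro sum.mono_neutral_left) (auto simp: in_keys_iff)

lemma mpoly_eval_zero [simp]: "mpoly_eval 0 x = 0"
  by (simp add: mpoly_eval_def)

lemma mpoly_eval_add: "mpoly_eval (p + p') x = mpoly_eval p x + mpoly_eval p' x"
  using mpoly_eval_superset[of "Poly_Mapping.keys p \<union> Poly_Mapping.keys p'" p x]
    mpoly_eval_superset[of "Poly_Mapping.keys p \<union> Poly_Mapping.keys p'" p' x]
    mpoly_eval_superset[of "Poly_Mapping.keys p \<union> Poly_Mapping.keys p'" "p + p'" x] keys_add[of p p']
  by (simp add: lookup_add sum.distrib distrib_right)

lemma mpoly_eval_scaleR: "mpoly_eval (c *\<^sub>R p) x = c * mpoly_eval p x"
  using mpoly_eval_superset[of "Poly_Mapping.keys p" "c *\<^sub>R p" x] keys_scaleR[of c p]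
  by (simp add: mpoly_eval_def sum_distrib_left mult.assoc)

lemma linear_eval_field: "linear (\<lambda>\<xi>. eval_field \<xi> x)"
  by (rule linearI) (simp_all add: eval_field_def vec_eq_iff mpoly_eval_add mpoly_eval_scaleR)

lemma subspace_tangent_fields: "subspace (tangent_fields m h \<nu>)"
  unfolding subspace_def tangent_fields_def
  by (auto simp: linear_0[OF linear_eval_field] linear_add[OF linear_eval_field]
      linear_scale[OF linear_eval_field] inner_add_left)

lemma subspace_keys: "subspace {\<xi> :: 'n::finite poly_field. \<forall>q. Poly_Mapping.keys (\<xi> $ q) \<subseteq> K}"
proof (rule subspaceI)
  show "(0 :: 'n poly_field) \<in> {\<xi>. \<forall>q. Poly_Mapping.keys (\<xi> $ q) \<subseteq> K}"
    by simp
next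
  fix \<xi> \<eta> :: "'n poly_field"
  assume "\<xi> \<in> {\<xi>. \<forall>q. Poly_Mapping.keys (\<xi> $ q) \<subseteq> K}" "\<eta> \<in> {\<xi>. \<forall>q. Poly_Mapping.keys (\<xi> $ q) \<subseteq> K}"
  then have "Poly_Mapping.keys ((\<xi> + \<eta>) $ q) \<subseteq> K" for q
    using keys_add[of "\<xi> $ q" "\<eta> $ q"] by (simp only: vector_add_component) blast
  then show "\<xi> + \<eta> \<in> {\<xi>. \<forall>q. Poly_Mapping.keys (\<xi> $ q) \<subseteq> K}"
    by blast
next
  fix c and \<xi> :: "'n poly_field"
  assume "\<xi> \<in> {\<xi>. \<forall>q. Poly_Mapping.keys (\<xi> $ q) \<subseteq> K}"
  then have "Poly_Mapping.keys ((c *\<^sub>R \<xi>) $ q) \<subseteq> K" for q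
    using keys_scaleR[of c "\<xi> $ q"] by (simp only: vector_scaleR_component) blast
  then show "c *\<^sub>R \<xi> \<in> {\<xi>. \<forall>q. Poly_Mapping.keys (\<xi> $ q) \<subseteq> K}"
    by blast
qed

lemma subspace_Poly_bd_le: "subspace (Poly_bd_le m \<alpha> \<l> k)"
proof -
  have "Poly_bd_le m \<alpha> \<l> k = tangent_fields m (aff \<alpha> \<l>) \<alpha> \<inter>
      {\<xi>. \<forall>q. Poly_Mapping.keys (\<xi> $ q) \<subseteq> {u. mdeg u \<le> k}}"
    unfolding Poly_bd_le_def deg_le_def by blast
  then show ?thesis
    by (simp only: subspace_inter[OF subspace_tangent_fields subspace_keys])
qed

lemma subspace_Poly_bd_cone: "subspace (Poly_bd_cone m \<alpha> \<l> k)"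
proof -
  have "Poly_bd_cone m \<alpha> \<l> k = tangent_fields m (cone_form \<alpha> \<l>) (cone_normal \<alpha> \<l>) \<inter>
      {\<xi>. \<forall>q. Poly_Mapping.keys (\<xi> $ q) \<subseteq> {u. mdeg u = k}}"
    unfolding Poly_bd_cone_def homogeneous_of_deg_def by blast
  then show ?thesis
    by (simp only: subspace_inter[OF subspace_tangent_fields subspace_keys])
qed

lemma subspace_Poly_bd_cone_par: "subspace (Poly_bd_cone_par m \<alpha> \<l> k)"
  using subspace_Poly_bd_cone[of m \<alpha> \<l> k] unfolding subspace_def Poly_bd_cone_par_def by auto

end

theory Submission
  imports Defs
begin

text \<open>Homogenization with the new coordinate \<open>x\<^sub>0\<close> is inverse to setting \<open>x\<^sub>0 = 1\<close>, so only the
  boundary conditions have to be compared. A facet \<open>F\<^sub>i\<close> is the part of the facet of the cone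
  over \<open>x\<^sub>0 = 1\<close>, and homogeneity transports the condition from there to the points with
  \<open>x\<^sub>0 > 0\<close>. The cone is not contained in \<open>x\<^sub>0 \<ge> 0\<close>; but by irredundancy \<open>F\<^sub>i\<close> contains a point
  \<open>p\<close>, and for \<open>y\<close> in the facet of the cone the ray \<open>y + s (1, p)\<close>, \<open>s \<ge> 0\<close>, stays in that facet
  and eventually has \<open>x\<^sub>0 > 0\<close>. The condition along the ray is polynomial in \<open>s\<close>, so it
  holds at \<open>s = 0\<close>, too.\<close>

section \<open>Homogenization of polynomials\<close>

text \<open>\<open>map_key Some\<close> drops the exponent of \<open>x_0\<close>, which is the
  effect of setting \<open>x_0 = 1\<close> in a monomial.\<close>

lemma lookup_map_key_Some [simp]:
  "Poly_Mapping.lookup (Poly_Mapping.map_key Some n) q = Poly_Mapping.lookup n (Some q)"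
  by (simp add: Poly_Mapping.map_key.rep_eq)

lemma mdeg_option: "mdeg n = Poly_Mapping.lookup n None + mdeg (Poly_Mapping.map_key Some n)"
  by (simp add: mdeg_def UNIV_option_conv sum.reindex)

text \<open>For \<open>mdeg u > k\<close> the truncated subtraction gives an exponent of degree different from \<open>k\<close>.\<close>

definition ext_exponent :: "nat \<Rightarrow> ('n::finite \<Rightarrow>\<^sub>0 nat) \<Rightarrow> 'n option \<Rightarrow>\<^sub>0 nat" where
  "ext_exponent k u = Abs_poly_mapping
     (\<lambda>r. case r of None \<Rightarrow> k - mdeg u | Some q \<Rightarrow> Poly_Mapping.lookup u q)"

lemma lookup_ext_exponent: "Poly_Mapping.lookup (ext_exponent k u) r =
    (case r of None \<Rightarrow> k - mdeg u | Some q \<Rightarrow> Poly_Mapping.lookup u q)"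
  unfolding ext_exponent_def by (subst Abs_poly_mapping_inverse) simp_all

lemma map_key_ext_exponent [simp]: "Poly_Mapping.map_key Some (ext_exponent k u) = u"
  by (rule poly_mapping_eqI) (simp add: lookup_ext_exponent)

lemma inj_ext_exponent: "inj (ext_exponent k)"
  by (rule inj_on_inverseI) (rule map_key_ext_exponent)

lemma mdeg_ext_exponent: "mdeg (ext_exponent k u) = max k (mdeg u)"
  by (simp add: mdeg_option[of "ext_exponent k u"] lookup_ext_exponent)

lemma ext_exponent_map_key:
  assumes "mdeg n = k"
  shows "ext_exponent k (Poly_Mapping.map_key Some n) = n"
  using assms
  by (intro poly_mapping_eqI) (auto simp: lookup_ext_exponent mdeg_option split: option.split)

text \<open>Terms of degree above \<open>k\<close> are discarded, so the map is linear on all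
  polynomials, not only on those of degree at most \<open>k\<close>.\<close>

definition homogenize :: "nat \<Rightarrow> 'n::finite rpoly \<Rightarrow> 'n option rpoly" where
  "homogenize k p = Abs_poly_mapping
     (\<lambda>n. if mdeg n = k then Poly_Mapping.lookup p (Poly_Mapping.map_key Some n) else 0)"

lemma lookup_homogenize: "Poly_Mapping.lookup (homogenize k p) n =
    (if mdeg n = k then Poly_Mapping.lookup p (Poly_Mapping.map_key Some n) else 0)"
proof -
  \<comment> \<open>An exponent of degree \<open>k\<close> is recovered from its restriction by
    \<open>ext_exponent k\<close>, so the support is bounded by the finitely many terms of
    \<open>p\<close>.\<close>
  have "{n. (if mdeg n = k then Poly_Mapping.lookup p (Poly_Mapping.map_key Some n) else 0) \<noteq> 0}
      \<subseteq> ext_exponent k ` Poly_Mapping.keys p"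
    by (auto simp: in_keys_iff intro!: rev_image_eqI simp: ext_exponent_map_key split: if_splits)
  then have "finite {n. (if mdeg n = k then Poly_Mapping.lookup p (Poly_Mapping.map_key Some n) else 0) \<noteq> 0}"
    by (rule finite_subset) simp
  then show ?thesis
    unfolding homogenize_def by (subst Abs_poly_mapping_inverse) simp_all
qed

lemma homogenize_add: "homogenize k (p + p') = homogenize k p + homogenize k p'"
  by (rule poly_mapping_eqI) (simp add: lookup_homogenize lookup_add)

lemma homogenize_scaleR: "homogenize k (c *\<^sub>R p) = c *\<^sub>R homogenize k p"
  by (rule poly_mapping_eqI) (simp add: lookup_homogenize)

lemma homogeneous_of_deg_homogenize: "homogeneous_of_deg k (homogenize k p)"
  by (auto simp: homogeneous_of_deg_def in_keys_iff lookup_homogenize split: if_splits)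

lemma homogeneous_of_deg_zero [simp]: "homogeneous_of_deg k 0"
  by (simp add: homogeneous_of_deg_def)

text \<open>On homogeneous polynomials of degree \<open>k\<close> this is the substitution
  \<open>x_0 = 1\<close>: distinct exponents of degree \<open>k\<close> have distinct restrictions,
  so no coefficients have to be added up.\<close>

definition dehomogenize :: "nat \<Rightarrow> 'n::finite option rpoly \<Rightarrow> 'n rpoly" where
  "dehomogenize k p = Poly_Mapping.map_key (ext_exponent k) p"

lemma lookup_dehomogenize:
  "Poly_Mapping.lookup (dehomogenize k p) u = Poly_Mapping.lookup p (ext_exponent k u)"
  by (simp add: dehomogenize_def Poly_Mapping.map_key.rep_eq inj_ext_exponent)

text \<open>If \<open>mdeg u > k\<close>, then \<open>ext_exponent k u\<close> has degree
  \<open>mdeg u\<close>, and its coefficient in \<open>p\<close> vanishes by homogeneity.\<close>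

lemma deg_le_dehomogenize:
  assumes "homogeneous_of_deg k p"
  shows "deg_le k (dehomogenize k p)"
  using assms
  by (force simp: homogeneous_of_deg_def deg_le_def in_keys_iff lookup_dehomogenize
      mdeg_ext_exponent)

lemma homogenize_dehomogenize:
  assumes "homogeneous_of_deg k p"
  shows "homogenize k (dehomogenize k p) = p"
  using assms
  by (intro poly_mapping_eqI)
    (auto simp: homogeneous_of_deg_def in_keys_iff lookup_homogenize lookup_dehomogenize
      ext_exponent_map_key)

lemma dehomogenize_homogenize:
  assumes "deg_le k p"
  shows "dehomogenize k (homogenize k p) = p"
  using assms
  by (intro poly_mapping_eqI)
    (force simp: deg_le_def in_keys_iff lookup_homogenize lookup_dehomogenize mdeg_ext_exponent
      max_def)

text \<open>Serves to reindex the sum that defines evaluation; by the degree bound no term is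
  lost.\<close>

lemma keys_homogenize:
  assumes "deg_le k p"
  shows "Poly_Mapping.keys (homogenize k p) = ext_exponent k ` Poly_Mapping.keys p"
proof (intro equalityI subsetI)
  fix n assume "n \<in> Poly_Mapping.keys (homogenize k p)"
  then show "n \<in> ext_exponent k ` Poly_Mapping.keys p"
    by (intro rev_image_eqI[of "Poly_Mapping.map_key Some n"])
      (auto simp: in_keys_iff lookup_homogenize ext_exponent_map_key split: if_splits)
qed (use assms in \<open>auto simp: deg_le_def in_keys_iff lookup_homogenize mdeg_ext_exponent\<close>)

section \<open>Evaluation\<close>

definition cone_point :: "real ^ 'n::finite \<Rightarrow> real ^ 'n option" where
  "cone_point x = (\<chi> r. case r of None \<Rightarrow> 1 | Some q \<Rightarrow> x $ q)"

text \<open>The additional factor \<open>x_0 ^ (k - mdeg u)\<close> of each monomial equals 1 on the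
  hyperplane \<open>x_0 = 1\<close>.\<close>

lemma mpoly_eval_homogenize:
  assumes "deg_le k p"
  shows "mpoly_eval (homogenize k p) (cone_point x) = mpoly_eval p x"
  unfolding mpoly_eval_def keys_homogenize[OF assms] using assms
  by (subst sum.reindex)
    (auto intro!: sum.cong inj_on_subset[OF inj_ext_exponent]
      simp: lookup_homogenize mdeg_ext_exponent deg_le_def UNIV_option_conv prod.reindex
        cone_point_def lookup_ext_exponent)

lemma mpoly_eval_homogeneous:
  assumes "homogeneous_of_deg k p"
  shows "mpoly_eval p (c *\<^sub>R x) = c ^ k * mpoly_eval p x"
  using assms
  by (auto simp: mpoly_eval_def homogeneous_of_deg_def mdeg_def power_mult_distrib prod.distrib
      power_sum sum_distrib_left intro!: sum.cong)

lemma eval_field_homogeneous: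
  assumes "\<And>r. homogeneous_of_deg k (\<xi> $ r)"
  shows "eval_field \<xi> (c *\<^sub>R x) = c ^ k *\<^sub>R eval_field \<xi> x"
  by (simp add: eval_field_def vec_eq_iff mpoly_eval_homogeneous[OF assms])

text \<open>Each coordinate on the line is the polynomial \<open>[:x $ q, v $ q:]\<close> in
  \<open>s\<close>; these are substituted into \<open>p\<close>.\<close>

lemma mpoly_eval_line: "\<exists>q. \<forall>s. mpoly_eval p (x + s *\<^sub>R v) = poly q s"
proof (intro exI allI)
  fix s
  show "mpoly_eval p (x + s *\<^sub>R v) =
      poly (\<Sum>m\<in>Poly_Mapping.keys p. [:Poly_Mapping.lookup p m:] *
        (\<Prod>q\<in>UNIV. [:x $ q, v $ q:] ^ Poly_Mapping.lookup m q)) s"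
    by (simp add: mpoly_eval_def poly_sum poly_prod)
qed

lemma eval_field_line: "\<exists>q. \<forall>s. eval_field \<xi> (x + s *\<^sub>R v) \<bullet> w = poly q s"
proof -
  obtain Q where Q: "mpoly_eval (\<xi> $ r) (x + s *\<^sub>R v) = poly (Q r) s" for r s
    using mpoly_eval_line[of "\<xi> $ r" x v for r] by metis
  have "eval_field \<xi> (x + s *\<^sub>R v) \<bullet> w = poly (\<Sum>r\<in>UNIV. Q r * [:w $ r:]) s" for s
    by (simp add: eval_field_def inner_vec_def Q poly_sum mult.commute)
  then show ?thesis
    by blast
qed

lemma poly_eq_0_if_eventually_0:
  fixes q :: "real poly"
  assumes "\<And>s. s > c \<Longrightarrow> poly q s = 0"
  shows "q = 0"
proof (rule ccontr)
  assume "q \<noteq> 0"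
  then have "finite {s. poly q s = 0}"
    by (rule poly_roots_finite)
  then have "finite {c<..}"
    by (rule rev_finite_subset) (use assms in auto)
  then show False
    by (simp add: infinite_Ioi)
qed

section \<open>Facets\<close>

text \<open>The set is closed, so its frontier consists of its non-interior points. Since
  \<open>\<nu> i \<noteq> 0\<close>, interior points satisfy \<open>h i x < 0\<close>, so every
  point of the set with \<open>h i x = 0\<close> is on the frontier. This covers the affine case
  and, with \<open>c = 0\<close>, the cone.\<close>

lemma facet_eq:
  fixes \<nu> :: "nat \<Rightarrow> 'a::euclidean_space"
  assumes h: "\<And>j x. h j x = \<nu> j \<bullet> x + c j" and i: "i \<in> {1..m}" and "\<nu> i \<noteq> 0"
  shows "facet m h i = {x. h i x = 0 \<and> (\<forall>j\<in>{1..m}. h j x \<le> 0)}"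
proof -
  have half: "{x. h j x \<le> 0} = {x. \<nu> j \<bullet> x \<le> - c j}" for j
    by (auto simp: h)
  have "closed (polyhedral_set m h)"
    unfolding polyhedral_set_def half by (auto intro: closed_halfspace_le)
  moreover have "interior (polyhedral_set m h) \<subseteq> {x. h i x < 0}"
  proof -
    have "polyhedral_set m h \<subseteq> {x. \<nu> i \<bullet> x \<le> - c i}"
      using i unfolding polyhedral_set_def half by blast
    from interior_mono[OF this] show ?thesis
      using interior_halfspace_le[OF \<open>\<nu> i \<noteq> 0\<close>, of "- c i"] by (auto simp: h)
  qed
  ultimately show ?thesis
    by (auto simp: facet_def frontier_def polyhedral_set_def)
qed

text \<open>A segment from a point of the polyhedron to a point violating only the inequality
  \<open>i\<close> meets the hyperplane \<open>i\<close>; the other inequalities persist by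
  convexity.\<close>

lemma irredundant_facet_point:
  fixes \<alpha> :: "nat \<Rightarrow> real ^ 'n::finite"
  assumes "irredundant m (aff \<alpha> \<l>)" "polyhedral_set m (aff \<alpha> \<l>) \<noteq> {}" and i: "i \<in> {1..m}"
  obtains p where "aff \<alpha> \<l> i p = 0" "\<And>j. j \<in> {1..m} \<Longrightarrow> aff \<alpha> \<l> j p \<le> 0"
proof -
  obtain z where z: "\<And>j. j \<in> {1..m} \<Longrightarrow> aff \<alpha> \<l> j z \<le> 0"
    using assms(2) unfolding polyhedral_set_def by blast
  obtain y where y: "\<And>j. j \<in> {1..m} - {i} \<Longrightarrow> aff \<alpha> \<l> j y \<le> 0"
    and y_notin: "y \<notin> polyhedral_set m (aff \<alpha> \<l>)"
    using assms(1) i unfolding irredundant_def by blast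
  have yi: "aff \<alpha> \<l> i y > 0"
  proof (rule ccontr)
    assume "\<not> aff \<alpha> \<l> i y > 0"
    then have "aff \<alpha> \<l> j y \<le> 0" if "j \<in> {1..m}" for j
      using y[of j] that by (cases "j = i") auto
    then show False
      using y_notin by (auto simp: polyhedral_set_def)
  qed
  define a b where "a = aff \<alpha> \<l> i y" and "b = - aff \<alpha> \<l> i z"
  have ab: "a > 0" "b \<ge> 0"
    using yi z[OF i] by (simp_all add: a_def b_def)
  \<comment> \<open>The form \<open>i\<close> is affine with values \<open>- b\<close> at
    \<open>z\<close> and \<open>a\<close> at \<open>y\<close>; these weights make it vanish. As
    \<open>a > 0\<close>, the denominator is positive even if \<open>b = 0\<close>.\<close>
  define p where "p = (a / (a + b)) *\<^sub>R z + (b / (a + b)) *\<^sub>R y"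
  have p: "aff \<alpha> \<l> j p = (a / (a + b)) * aff \<alpha> \<l> j z + (b / (a + b)) * aff \<alpha> \<l> j y" for j
  proof -
    have "(a / (a + b)) * \<l> j + (b / (a + b)) * \<l> j = \<l> j"
      using ab by (simp add: add_divide_distrib[symmetric] distrib_right[symmetric])
    then show ?thesis
      by (simp add: aff_def p_def inner_add_right distrib_left)
  qed
  have pi: "aff \<alpha> \<l> i p = 0"
  proof -
    have "aff \<alpha> \<l> i y = a" "aff \<alpha> \<l> i z = - b"
      by (simp_all add: a_def b_def)
    then show ?thesis
      by (simp add: p)
  qed
  moreover have "aff \<alpha> \<l> j p \<le> 0" if "j \<in> {1..m}" for j
  proof (cases "j = i")
    case False
    then show ?thesis
      unfolding p using ab z[of j] y[of j] that
      by (intro add_nonpos_nonpos mult_nonneg_nonpos) auto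
  qed (simp add: pi)
  ultimately show thesis
    using that by blast
qed

section \<open>The linear forms of the cone\<close>

lemma cone_form_scaleR: "cone_form \<alpha> \<l> i (c *\<^sub>R x) = c * cone_form \<alpha> \<l> i x"
  by (simp add: cone_form_eq_inner)

lemma cone_form_add: "cone_form \<alpha> \<l> i (x + y) = cone_form \<alpha> \<l> i x + cone_form \<alpha> \<l> i y"
  by (simp add: cone_form_eq_inner inner_add_right)

lemma cone_form_cone_point: "cone_form \<alpha> \<l> i (cone_point x) = aff \<alpha> \<l> i x"
  by (simp add: cone_form_def cone_point_def aff_def inner_vec_def)

lemma cone_normal_nonzero: "\<alpha> i \<noteq> 0 \<Longrightarrow> cone_normal \<alpha> \<l> i \<noteq> 0"
  by (auto simp: cone_normal_def vec_eq_iff split: option.splits)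

section \<open>The isomorphism\<close>

definition homogenize_field :: "nat \<Rightarrow> 'n::finite poly_field \<Rightarrow> 'n option poly_field" where
  "homogenize_field k \<xi> = (\<chi> r. case r of None \<Rightarrow> 0 | Some q \<Rightarrow> homogenize k (\<xi> $ q))"

definition dehomogenize_field :: "nat \<Rightarrow> 'n::finite option poly_field \<Rightarrow> 'n poly_field" where
  "dehomogenize_field k \<xi> = (\<chi> q. dehomogenize k (\<xi> $ Some q))"

lemma linear_homogenize_field: "linear (homogenize_field k)"
  by (rule linearI)
    (auto simp: homogenize_field_def vec_eq_iff homogenize_add homogenize_scaleR
      split: option.split)

lemma homogeneous_homogenize_field: "homogeneous_of_deg k (homogenize_field k \<xi> $ r)"
  by (simp add: homogenize_field_def homogeneous_of_deg_homogenize split: option.split)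

lemma homogenize_field_None: "homogenize_field k \<xi> $ None = 0"
  by (simp add: homogenize_field_def)

lemma dehomogenize_homogenize_field:
  assumes "\<And>q. deg_le k (\<xi> $ q)"
  shows "dehomogenize_field k (homogenize_field k \<xi>) = \<xi>"
  by (simp add: dehomogenize_field_def homogenize_field_def vec_eq_iff
      dehomogenize_homogenize assms)

lemma homogenize_dehomogenize_field:
  assumes "\<And>r. homogeneous_of_deg k (\<xi> $ r)" "\<xi> $ None = 0"
  shows "homogenize_field k (dehomogenize_field k \<xi>) = \<xi>"
  by (simp add: dehomogenize_field_def homogenize_field_def vec_eq_iff
      homogenize_dehomogenize assms split: option.split)

text \<open>The component of the field at \<open>None\<close> is zero, so the entry
  \<open>\<l> i\<close> of the cone normal does not contribute.\<close>

lemma eval_homogenize_field: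
  assumes "\<And>q. deg_le k (\<xi> $ q)"
  shows "eval_field (homogenize_field k \<xi>) (cone_point x) \<bullet> cone_normal \<alpha> \<l> i
    = eval_field \<xi> x \<bullet> \<alpha> i"
  by (simp add: inner_vec_def UNIV_option_conv sum.reindex eval_field_def homogenize_field_def
      cone_normal_def mpoly_eval_homogenize assms)

lemma tangent_homogenize_field_iff:
  fixes \<alpha> :: "nat \<Rightarrow> real ^ 'n::finite"
  assumes \<alpha>: "\<And>i. i \<in> {1..m} \<Longrightarrow> \<alpha> i \<noteq> 0"
    and irred: "irredundant m (aff \<alpha> \<l>)"
    and nonempty: "polyhedral_set m (aff \<alpha> \<l>) \<noteq> {}"
    and deg: "\<And>q. deg_le k (\<xi> $ q)"
  shows "homogenize_field k \<xi> \<in> tangent_fields m (cone_form \<alpha> \<l>) (cone_normal \<alpha> \<l>)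
    \<longleftrightarrow> \<xi> \<in> tangent_fields m (aff \<alpha> \<l>) \<alpha>"
proof -
  have F: "facet m (aff \<alpha> \<l>) i = {x. aff \<alpha> \<l> i x = 0 \<and> (\<forall>j\<in>{1..m}. aff \<alpha> \<l> j x \<le> 0)}"
    if "i \<in> {1..m}" for i
    by (rule facet_eq[where \<nu> = \<alpha> and c = \<l>, OF _ that \<alpha>[OF that]]) (simp add: aff_def)
  have G: "facet m (cone_form \<alpha> \<l>) i =
      {x. cone_form \<alpha> \<l> i x = 0 \<and> (\<forall>j\<in>{1..m}. cone_form \<alpha> \<l> j x \<le> 0)}" if "i \<in> {1..m}" for i
    by (rule facet_eq[where \<nu> = "cone_normal \<alpha> \<l>" and c = "\<lambda>_. 0", OF _ that
          cone_normal_nonzero[where \<alpha> = \<alpha>, OF \<alpha>[OF that]]])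
      (simp add: cone_form_eq_inner)
  show ?thesis
  proof
    assume hom: "homogenize_field k \<xi> \<in> tangent_fields m (cone_form \<alpha> \<l>) (cone_normal \<alpha> \<l>)"
    show "\<xi> \<in> tangent_fields m (aff \<alpha> \<l>) \<alpha>"
      unfolding tangent_fields_def
    proof (intro CollectI ballI)
      fix i x assume i: "i \<in> {1..m}" and x: "x \<in> facet m (aff \<alpha> \<l>) i"
      then have "cone_point x \<in> facet m (cone_form \<alpha> \<l>) i"
        by (simp add: F G cone_form_cone_point)
      with hom i have "eval_field (homogenize_field k \<xi>) (cone_point x) \<bullet> cone_normal \<alpha> \<l> i = 0"
        unfolding tangent_fields_def by blast
      then show "eval_field \<xi> x \<bullet> \<alpha> i = 0"
        by (simp add: eval_homogenize_field deg)
    qed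
  next
    assume tan: "\<xi> \<in> tangent_fields m (aff \<alpha> \<l>) \<alpha>"
    show "homogenize_field k \<xi> \<in> tangent_fields m (cone_form \<alpha> \<l>) (cone_normal \<alpha> \<l>)"
      unfolding tangent_fields_def
    proof (intro CollectI ballI)
      fix i y assume i: "i \<in> {1..m}" and "y \<in> facet m (cone_form \<alpha> \<l>) i"
      then have y: "cone_form \<alpha> \<l> i y = 0" "cone_form \<alpha> \<l> j y \<le> 0" if "j \<in> {1..m}" for j
        using that by (simp_all add: G)
      obtain p where p: "aff \<alpha> \<l> i p = 0" "\<And>j. j \<in> {1..m} \<Longrightarrow> aff \<alpha> \<l> j p \<le> 0"
        using irredundant_facet_point[OF irred nonempty i] by blast
      let ?\<eta> = "homogenize_field k \<xi>" and ?\<nu> = "cone_normal \<alpha> \<l> i"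
      have positive: "eval_field ?\<eta> z \<bullet> ?\<nu> = 0"
        if "z $ None > 0" "cone_form \<alpha> \<l> i z = 0" "\<And>j. j \<in> {1..m} \<Longrightarrow> cone_form \<alpha> \<l> j z \<le> 0" for z
      proof -
        \<comment> \<open>Central projection of \<open>z\<close> to the hyperplane
          \<open>x_0 = 1\<close>. Since \<open>c > 0\<close>, the signs of all forms are preserved,
          and the field only changes by the factor \<open>c ^ k\<close>.\<close>
        define c x where "c = z $ None" and "x = (\<chi> q. z $ Some q / c)"
        have "c > 0"
          using that by (simp add: c_def)
        then have z: "z = c *\<^sub>R cone_point x"
          by (auto simp: vec_eq_iff cone_point_def x_def c_def split: option.split)
        have aff: "cone_form \<alpha> \<l> j z = c * aff \<alpha> \<l> j x" for j
          by (simp add: z cone_form_scaleR cone_form_cone_point)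
        have "x \<in> facet m (aff \<alpha> \<l>) i"
          using that(2,3) \<open>c > 0\<close> by (simp add: F[OF i] aff mult_le_0_iff)
        then have "eval_field \<xi> x \<bullet> \<alpha> i = 0"
          using tan i unfolding tangent_fields_def by blast
        then show ?thesis
          by (simp add: z eval_field_homogeneous[OF homogeneous_homogenize_field]
              eval_homogenize_field deg)
      qed
      obtain q where q: "eval_field ?\<eta> (y + s *\<^sub>R cone_point p) \<bullet> ?\<nu> = poly q s" for s
        using eval_field_line by blast
      \<comment> \<open>The bound \<open>s > - y $ None\<close> makes the coordinate
        \<open>x_0\<close> positive; \<open>s > 0\<close> keeps the inequalities, because all forms
        are nonpositive at \<open>cone_point p\<close>.\<close>
      have "poly q s = 0" if "s > max 0 (- y $ None)" for s
        unfolding q[symmetric]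
      proof (rule positive)
        show "(y + s *\<^sub>R cone_point p) $ None > 0"
          using that by (simp add: cone_point_def)
        show "cone_form \<alpha> \<l> i (y + s *\<^sub>R cone_point p) = 0"
          using y(1)[OF i] p(1) by (simp add: cone_form_add cone_form_scaleR cone_form_cone_point)
        show "cone_form \<alpha> \<l> j (y + s *\<^sub>R cone_point p) \<le> 0" if "j \<in> {1..m}" for j
          using y(2)[OF that] p(2)[OF that] \<open>s > max 0 (- y $ None)\<close>
          by (auto simp: cone_form_add cone_form_scaleR cone_form_cone_point
              intro!: add_nonpos_nonpos mult_nonneg_nonpos)
      qed
      then have "q = 0"
        by (rule poly_eq_0_if_eventually_0)
      \<comment> \<open>The point \<open>y\<close> itself is the value \<open>s = 0\<close> of the
        parameter.\<close>
      then show "eval_field ?\<eta> y \<bullet> ?\<nu> = 0"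
        using q[of 0] by simp
    qed
  qed
qed

theorem lemma5p3:
  fixes \<alpha> :: "nat \<Rightarrow> real ^ 'n::finite" and \<l> :: "nat \<Rightarrow> real" and m k :: nat
  assumes "\<And>i. i \<in> {1..m} \<Longrightarrow> \<alpha> i \<noteq> 0"
    and "irredundant m (aff \<alpha> \<l>)"
    and "polyhedral_set m (aff \<alpha> \<l>) \<noteq> {}"
  shows "\<exists>\<phi> :: 'n poly_field \<Rightarrow> 'n option poly_field.
           linear \<phi> \<and> bij_betw \<phi> (Poly_bd_le m \<alpha> \<l> k) (Poly_bd_cone_par m \<alpha> \<l> k)"
proof (intro exI conjI)
  show "linear (homogenize_field k)"
    by (rule linear_homogenize_field)
  have tangent: "homogenize_field k \<xi> \<in> tangent_fields m (cone_form \<alpha> \<l>) (cone_normal \<alpha> \<l>)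
      \<longleftrightarrow> \<xi> \<in> tangent_fields m (aff \<alpha> \<l>) \<alpha>" if "\<And>q. deg_le k (\<xi> $ q)" for \<xi>
    by (rule tangent_homogenize_field_iff) (use assms that in auto)
  show "bij_betw (homogenize_field k) (Poly_bd_le m \<alpha> \<l> k) (Poly_bd_cone_par m \<alpha> \<l> k)"
  proof (rule bij_betw_byWitness[where f' = "dehomogenize_field k"])
    show "\<forall>\<xi>\<in>Poly_bd_le m \<alpha> \<l> k. dehomogenize_field k (homogenize_field k \<xi>) = \<xi>"
      by (simp add: Poly_bd_le_def dehomogenize_homogenize_field)
    show inv: "\<forall>\<eta>\<in>Poly_bd_cone_par m \<alpha> \<l> k. homogenize_field k (dehomogenize_field k \<eta>) = \<eta>"
      by (simp add: Poly_bd_cone_par_def Poly_bd_cone_def homogenize_dehomogenize_field)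
    show "homogenize_field k ` Poly_bd_le m \<alpha> \<l> k \<subseteq> Poly_bd_cone_par m \<alpha> \<l> k"
    proof (intro image_subsetI)
      fix \<xi> assume \<xi>: "\<xi> \<in> Poly_bd_le m \<alpha> \<l> k"
      then have deg: "deg_le k (\<xi> $ q)" for q
        by (simp add: Poly_bd_le_def)
      show "homogenize_field k \<xi> \<in> Poly_bd_cone_par m \<alpha> \<l> k"
        using \<xi> tangent[OF deg]
        by (simp add: Poly_bd_le_def Poly_bd_cone_par_def Poly_bd_cone_def
            homogeneous_homogenize_field homogenize_field_None)
    qed
    show "dehomogenize_field k ` Poly_bd_cone_par m \<alpha> \<l> k \<subseteq> Poly_bd_le m \<alpha> \<l> k"
    proof (intro image_subsetI)
      fix \<eta> assume \<eta>: "\<eta> \<in> Poly_bd_cone_par m \<alpha> \<l> k"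
      then have deg: "deg_le k (dehomogenize_field k \<eta> $ q)" for q
        by (simp add: Poly_bd_cone_par_def Poly_bd_cone_def dehomogenize_field_def
            deg_le_dehomogenize)
      show "dehomogenize_field k \<eta> \<in> Poly_bd_le m \<alpha> \<l> k"
        \<comment> \<open>Homogenizing the dehomogenized field returns \<open>\<eta>\<close>, so the
          tangency of \<open>\<eta>\<close> is the left side of the equivalence
          \<open>tangent\<close>.\<close>
        using \<eta> inv tangent[OF deg] deg
        by (simp add: Poly_bd_le_def Poly_bd_cone_par_def Poly_bd_cone_def)
    qed
  qed
qed

end
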